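(* Let $\mathcal C$ be a balanced factorization category, $X$ an object of $\mathcal C$, $x,y:1\to X$ points, and let $c_{x,y}:X[x,y]\to X(x,y)=\pi_0X[x,y]$ be the reflection map in internal sets. Let $i:S\to X[x,y]$ be the pullback of $i_x:1\to x\backslash X$ along the projection $p_{x,y}:X[x,y]\to x\backslash X$ and $e:S'\to X[x,y]$ the pullback of $e_y:1\to X/y$ along the projection $q_{x,y}:X[x,y]\to X/y$. Then $c_{x,y}\circ i$ and $c_{x,y}\circ e$ are isomorphisms, and with $i_{x,y}:=i\circ(c_{x,y}i)^{-1}$ and $e_{x,y}:=e\circ(c_{x,y}e)^{-1}$ one has a balanced cylinder $$i_{x,y},\,e_{x,y}:X(x,y)\rightrightarrows X[x,y]\xrightarrow{\ c_{x,y}\ }X(x,y),$$ that is, $c_{x,y}i_{x,y}=c_{x,y}e_{x,y}=\mathrm{id}$, with $i_{x,y}\in\mathcal E'$, $e_{x,y}\in\mathcal E$ and $c_{x,y}\in\mathcal E\cap\mathcal E'$. Moreover, for every element $\alpha:1\to X(x,y)$, if $[\alpha]$ denotes the pullback of $c_{x,y}$ along $\alpha$, then the points $1\to[\alpha]$ induced by $i_{x,y}\circ\alpha$ and $e_{x,y}\circ\alpha$ are in $\mathcal E'$ and in $\mathcal E$ respectively.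
   Context: A balanced factorization category is a finitely complete category $\mathcal C$ with two (orthogonal) factorization systems $(\mathcal E,\mathcal M)$ and $(\mathcal E',\mathcal M')$ such that $\mathcal M/1=\mathcal M'/1$ (an object $S$ has $S\to 1$ in $\mathcal M$ iff in $\mathcal M'$), and such that the pullback of a map in $\mathcal E$ along a map in $\mathcal M'$ is in $\mathcal E$, and the pullback of a map in $\mathcal E'$ along a map in $\mathcal M$ is in $\mathcal E'$. Factorizations are chosen. Internal sets are the objects $S$ with $S\to1$ in $\mathcal M$ (equivalently $\mathcal M'$); they form a reflective full subcategory $\mathcal S$ with reflection $\pi_0:\mathcal C\to\mathcal S$ (the reflection map of $Z$ is obtained by factorizing $Z\to1$). A point $x:1\to X$ factors as $1\xrightarrow{e_x}X/x\xrightarrow{\downarrow x}X$ with $e_x\in\mathcal E$, $\downarrow x\in\mathcal M$ (slice), and as $1\xrightarrow{i_x}x\backslash X\xrightarrow{\uparrow x}X$ with $i_x\in\mathcal E'$, $\uparrow x\in\mathcal M'$ (coslice). $X[x,y]$ is the pullback of $\uparrow x:x\backslash X\to X$ and $\downarrow y:X/y\to X$, with projections $p_{x,y}$ to $x\backslash X$ and $q_{x,y}$ to $X/y$. *)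

theory Defs
  imports Main
begin

section \<open>Categories\<close>

record ('o, 'a) cat =
  Obj :: "'o set"
  Arr :: "'a set"
  Dom :: "'a \<Rightarrow> 'o"
  Cod :: "'a \<Rightarrow> 'o"
  Ide :: "'o \<Rightarrow> 'a"
  Comp :: "'a \<Rightarrow> 'a \<Rightarrow> 'a"  (infixr \<open>\<cdot>\<index>\<close> 70)

definition hom :: "('o, 'a, 'z) cat_scheme \<Rightarrow> 'o \<Rightarrow> 'o \<Rightarrow> 'a set" where
  "hom C A B = {f \<in> Arr C. Dom C f = A \<and> Cod C f = B}"

locale category =
  fixes C :: "('o, 'a, 'z) cat_scheme" (structure)
  assumes Dom_Obj: "f \<in> Arr C \<Longrightarrow> Dom C f \<in> Obj C"
    and Cod_Obj: "f \<in> Arr C \<Longrightarrow> Cod C f \<in> Obj C"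
    and Ide_hom: "A \<in> Obj C \<Longrightarrow> Ide C A \<in> hom C A A"
    and Comp_hom: "f \<in> hom C A B \<Longrightarrow> g \<in> hom C B D \<Longrightarrow> g \<cdot> f \<in> hom C A D"
    and Comp_Ide_right: "f \<in> hom C A B \<Longrightarrow> f \<cdot> Ide C A = f"
    and Comp_Ide_left: "f \<in> hom C A B \<Longrightarrow> Ide C B \<cdot> f = f"
    and Comp_assoc: "f \<in> hom C A B \<Longrightarrow> g \<in> hom C B D \<Longrightarrow> h \<in> hom C D F \<Longrightarrow>
      (h \<cdot> g) \<cdot> f = h \<cdot> (g \<cdot> f)"

definition inverse_arrows :: "('o, 'a, 'z) cat_scheme \<Rightarrow> 'a \<Rightarrow> 'a \<Rightarrow> bool" where
  "inverse_arrows C f g \<longleftrightarrow> f \<in> Arr C \<and> g \<in> hom C (Cod C f) (Dom C f) \<and>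
     g \<cdot>\<^bsub>C\<^esub> f = Ide C (Dom C f) \<and> f \<cdot>\<^bsub>C\<^esub> g = Ide C (Cod C f)"

definition is_iso :: "('o, 'a, 'z) cat_scheme \<Rightarrow> 'a \<Rightarrow> bool" where
  "is_iso C f \<longleftrightarrow> (\<exists>g. inverse_arrows C f g)"

definition inv_arr :: "('o, 'a, 'z) cat_scheme \<Rightarrow> 'a \<Rightarrow> 'a" where
  "inv_arr C f = (THE g. inverse_arrows C f g)"

definition is_terminal :: "('o, 'a, 'z) cat_scheme \<Rightarrow> 'o \<Rightarrow> bool" where
  "is_terminal C T \<longleftrightarrow> T \<in> Obj C \<and> (\<forall>A \<in> Obj C. \<exists>!f. f \<in> hom C A T)"

text \<open>
  A commutative square, given by legs \<open>p\<close>, \<open>q\<close> out of \<open>P\<close> over the cospan \<open>f\<close>, \<open>g\<close>; the leg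
  \<open>q\<close> is opposite to \<open>f\<close>, so that \<open>q\<close> is the pullback of \<open>f\<close> along \<open>g\<close>, and
  \<open>p\<close> is the pullback of \<open>g\<close> along \<open>f\<close>.
\<close>

definition comm_square :: "('o, 'a, 'z) cat_scheme \<Rightarrow> 'o \<Rightarrow> 'a \<Rightarrow> 'a \<Rightarrow> 'a \<Rightarrow> 'a \<Rightarrow> bool" where
  "comm_square C P p q f g \<longleftrightarrow> f \<in> Arr C \<and> g \<in> Arr C \<and> Cod C f = Cod C g \<and>
     p \<in> hom C P (Dom C f) \<and> q \<in> hom C P (Dom C g) \<and> f \<cdot>\<^bsub>C\<^esub> p = g \<cdot>\<^bsub>C\<^esub> q"

definition induced_by :: "('o, 'a, 'z) cat_scheme \<Rightarrow> 'o \<Rightarrow> 'a \<Rightarrow> 'a \<Rightarrow> 'o \<Rightarrow> 'a \<Rightarrow> 'a \<Rightarrow> 'a \<Rightarrow> bool" where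
  "induced_by C P p q Q u v h \<longleftrightarrow> h \<in> hom C Q P \<and> p \<cdot>\<^bsub>C\<^esub> h = u \<and> q \<cdot>\<^bsub>C\<^esub> h = v"

definition is_pullback :: "('o, 'a, 'z) cat_scheme \<Rightarrow> 'o \<Rightarrow> 'a \<Rightarrow> 'a \<Rightarrow> 'a \<Rightarrow> 'a \<Rightarrow> bool" where
  "is_pullback C P p q f g \<longleftrightarrow> comm_square C P p q f g \<and>
     (\<forall>Q u v. comm_square C Q u v f g \<longrightarrow> (\<exists>!h. induced_by C P p q Q u v h))"


section \<open>Finite limits\<close>

definition is_functor ::
    "('j, 'k) cat \<Rightarrow> ('o, 'a, 'z) cat_scheme \<Rightarrow> ('j \<Rightarrow> 'o) \<Rightarrow> ('k \<Rightarrow> 'a) \<Rightarrow> bool" where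
  "is_functor J C Fo Fa \<longleftrightarrow>
     (\<forall>j \<in> Obj J. Fo j \<in> Obj C \<and> Fa (Ide J j) = Ide C (Fo j)) \<and>
     (\<forall>k \<in> Arr J. Fa k \<in> hom C (Fo (Dom J k)) (Fo (Cod J k))) \<and>
     (\<forall>k \<in> Arr J. \<forall>l \<in> Arr J. Cod J k = Dom J l \<longrightarrow> Fa (l \<cdot>\<^bsub>J\<^esub> k) = Fa l \<cdot>\<^bsub>C\<^esub> Fa k)"

definition is_cone ::
    "('j, 'k) cat \<Rightarrow> ('o, 'a, 'z) cat_scheme \<Rightarrow> ('j \<Rightarrow> 'o) \<Rightarrow> ('k \<Rightarrow> 'a) \<Rightarrow> 'o \<Rightarrow> ('j \<Rightarrow> 'a) \<Rightarrow> bool" where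
  "is_cone J C Fo Fa L l \<longleftrightarrow> L \<in> Obj C \<and> (\<forall>j \<in> Obj J. l j \<in> hom C L (Fo j)) \<and>
     (\<forall>k \<in> Arr J. Fa k \<cdot>\<^bsub>C\<^esub> l (Dom J k) = l (Cod J k))"

definition is_limit ::
    "('j, 'k) cat \<Rightarrow> ('o, 'a, 'z) cat_scheme \<Rightarrow> ('j \<Rightarrow> 'o) \<Rightarrow> ('k \<Rightarrow> 'a) \<Rightarrow> 'o \<Rightarrow> ('j \<Rightarrow> 'a) \<Rightarrow> bool" where
  "is_limit J C Fo Fa L l \<longleftrightarrow> is_cone J C Fo Fa L l \<and>
     (\<forall>N n. is_cone J C Fo Fa N n \<longrightarrow>
        (\<exists>!h. h \<in> hom C N L \<and> (\<forall>j \<in> Obj J. l j \<cdot>\<^bsub>C\<^esub> h = n j)))"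

text \<open>
  Every finite category is isomorphic to one whose objects and arrows are natural numbers, so
  restricting the shapes to the type \<open>nat\<close> loses no finite diagrams.
\<close>

definition finitely_complete :: "('o, 'a, 'z) cat_scheme \<Rightarrow> bool" where
  "finitely_complete C \<longleftrightarrow>
     (\<forall>(J :: (nat, nat) cat) Fo Fa.
        category J \<longrightarrow> finite (Obj J) \<longrightarrow> finite (Arr J) \<longrightarrow> is_functor J C Fo Fa \<longrightarrow>
        (\<exists>L l. is_limit J C Fo Fa L l))"


section \<open>Orthogonal factorization systems\<close>

definition orthogonal :: "('o, 'a, 'z) cat_scheme \<Rightarrow> 'a \<Rightarrow> 'a \<Rightarrow> bool" where
  "orthogonal C e m \<longleftrightarrow>
     (\<forall>u \<in> hom C (Dom C e) (Dom C m). \<forall>v \<in> hom C (Cod C e) (Cod C m).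
        m \<cdot>\<^bsub>C\<^esub> u = v \<cdot>\<^bsub>C\<^esub> e \<longrightarrow>
        (\<exists>!d. d \<in> hom C (Cod C e) (Dom C m) \<and> d \<cdot>\<^bsub>C\<^esub> e = u \<and> m \<cdot>\<^bsub>C\<^esub> d = v))"

definition factors_as ::
    "('o, 'a, 'z) cat_scheme \<Rightarrow> 'a set \<Rightarrow> 'a set \<Rightarrow> 'a \<Rightarrow> 'a \<Rightarrow> 'a \<Rightarrow> bool" where
  "factors_as C E M f e m \<longleftrightarrow> e \<in> E \<and> m \<in> M \<and> Dom C e = Dom C f \<and> Cod C e = Dom C m \<and>
     Cod C m = Cod C f \<and> m \<cdot>\<^bsub>C\<^esub> e = f"

definition closed_under_comp :: "('o, 'a, 'z) cat_scheme \<Rightarrow> 'a set \<Rightarrow> bool" where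
  "closed_under_comp C K \<longleftrightarrow> (\<forall>f \<in> K. \<forall>g \<in> K. Cod C f = Dom C g \<longrightarrow> g \<cdot>\<^bsub>C\<^esub> f \<in> K)"

definition factorization_system :: "('o, 'a, 'z) cat_scheme \<Rightarrow> 'a set \<Rightarrow> 'a set \<Rightarrow> bool" where
  "factorization_system C E M \<longleftrightarrow>
     E \<subseteq> Arr C \<and> M \<subseteq> Arr C \<and>
     (\<forall>f. is_iso C f \<longrightarrow> f \<in> E \<and> f \<in> M) \<and>
     closed_under_comp C E \<and> closed_under_comp C M \<and>
     (\<forall>e \<in> E. \<forall>m \<in> M. orthogonal C e m) \<and>
     (\<forall>f \<in> Arr C. \<exists>e m. factors_as C E M f e m)"


section \<open>Balanced factorization categories\<close>

text \<open>
  The data: a terminal object, two pairs of classes of arrows, and for each pair a choice of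
  the two parts of a factorization of every arrow.
\<close>

record ('o, 'a) bfc = "('o, 'a) cat" +
  one :: 'o
  clsE :: "'a set"
  clsM :: "'a set"
  clsE' :: "'a set"
  clsM' :: "'a set"
  facE :: "'a \<Rightarrow> 'a"
  facM :: "'a \<Rightarrow> 'a"
  facE' :: "'a \<Rightarrow> 'a"
  facM' :: "'a \<Rightarrow> 'a"

definition to_one :: "('o, 'a, 'z) bfc_scheme \<Rightarrow> 'o \<Rightarrow> 'a" where
  "to_one C A = (THE f. f \<in> hom C A (one C))"

locale balanced_factorization_category = category C
  for C :: "('o, 'a, 'z) bfc_scheme" (structure) +
  assumes fin_complete: "finitely_complete C"
    and terminal_one: "is_terminal C (one C)"
    and fact_EM: "factorization_system C (clsE C) (clsM C)"
    and fact_EM': "factorization_system C (clsE' C) (clsM' C)"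
    and chosen_fac: "f \<in> Arr C \<Longrightarrow> factors_as C (clsE C) (clsM C) f (facE C f) (facM C f)"
    and chosen_fac': "f \<in> Arr C \<Longrightarrow> factors_as C (clsE' C) (clsM' C) f (facE' C f) (facM' C f)"
    and same_over_one: "S \<in> Obj C \<Longrightarrow> to_one C S \<in> clsM C \<longleftrightarrow> to_one C S \<in> clsM' C"
    and E_stable: "is_pullback C P p q f g \<Longrightarrow> f \<in> clsE C \<Longrightarrow> g \<in> clsM' C \<Longrightarrow> q \<in> clsE C"
    and E'_stable: "is_pullback C P p q f g \<Longrightarrow> f \<in> clsE' C \<Longrightarrow> g \<in> clsM C \<Longrightarrow> q \<in> clsE' C"

definition internal_set :: "('o, 'a, 'z) bfc_scheme \<Rightarrow> 'o \<Rightarrow> bool" where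
  "internal_set C S \<longleftrightarrow> S \<in> Obj C \<and> to_one C S \<in> clsM C"

definition reflection_map :: "('o, 'a, 'z) bfc_scheme \<Rightarrow> 'o \<Rightarrow> 'o \<Rightarrow> 'a \<Rightarrow> bool" where
  "reflection_map C Z S c \<longleftrightarrow> c \<in> hom C Z S \<and> internal_set C S \<and>
     (\<forall>T f. internal_set C T \<longrightarrow> f \<in> hom C Z T \<longrightarrow>
        (\<exists>!g. g \<in> hom C S T \<and> g \<cdot>\<^bsub>C\<^esub> c = f))"

text \<open>
  For a point \<open>x : 1 \<rightarrow> X\<close>: \<open>X/x\<close> is \<open>Dom C (slice_map C x)\<close> and \<open>x\X\<close> is
  \<open>Dom C (coslice_map C x)\<close>.
\<close>

definition slice_pt :: "('o, 'a, 'z) bfc_scheme \<Rightarrow> 'a \<Rightarrow> 'a" where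
  "slice_pt C x = facE C x"

definition slice_map :: "('o, 'a, 'z) bfc_scheme \<Rightarrow> 'a \<Rightarrow> 'a" where
  "slice_map C x = facM C x"

definition coslice_pt :: "('o, 'a, 'z) bfc_scheme \<Rightarrow> 'a \<Rightarrow> 'a" where
  "coslice_pt C x = facE' C x"

definition coslice_map :: "('o, 'a, 'z) bfc_scheme \<Rightarrow> 'a \<Rightarrow> 'a" where
  "coslice_map C x = facM' C x"

definition balanced_cylinder ::
    "('o, 'a, 'z) bfc_scheme \<Rightarrow> 'o \<Rightarrow> 'o \<Rightarrow> 'a \<Rightarrow> 'a \<Rightarrow> 'a \<Rightarrow> bool" where
  "balanced_cylinder C S Z i e c \<longleftrightarrow>
     i \<in> hom C S Z \<and> e \<in> hom C S Z \<and> c \<in> hom C Z S \<and>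
     c \<cdot>\<^bsub>C\<^esub> i = Ide C S \<and> c \<cdot>\<^bsub>C\<^esub> e = Ide C S \<and>
     i \<in> clsE' C \<and> e \<in> clsE C \<and> c \<in> clsE C \<and> c \<in> clsE' C"


section \<open>Factorizing \<open>Z \<rightarrow> 1\<close> yields reflections in internal sets\<close>

context balanced_factorization_category
begin

lemma to_one_hom: "A \<in> Obj C \<Longrightarrow> to_one C A \<in> hom C A (one C)"
  using terminal_one theI'[of "\<lambda>f. f \<in> hom C A (one C)"]
  unfolding is_terminal_def to_one_def by blast

lemma to_one_unique: "f \<in> hom C A (one C) \<Longrightarrow> f = to_one C A"
  using terminal_one to_one_hom[of A] Dom_Obj[of f]
  unfolding is_terminal_def hom_def by blast

lemma reflection_aux:
  assumes fs: "factorization_system C E M"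
    and sets: "\<And>S. S \<in> Obj C \<Longrightarrow> internal_set C S \<longleftrightarrow> to_one C S \<in> M"
    and Z: "Z \<in> Obj C"
    and fac: "factors_as C E M (to_one C Z) e m"
  shows "reflection_map C Z (Cod C e) e"
proof -
  have e: "e \<in> E" "e \<in> hom C Z (Cod C e)" and m: "m \<in> M" "m \<in> hom C (Cod C e) (one C)"
    using fac fs to_one_hom[OF Z]
    unfolding factors_as_def factorization_system_def hom_def by auto
  have S: "Cod C e \<in> Obj C" using e(2) Cod_Obj unfolding hom_def by auto
  have "internal_set C (Cod C e)"
    using sets[OF S] m to_one_unique by metis
  moreover have "\<exists>!g. g \<in> hom C (Cod C e) T \<and> g \<cdot> e = f"
    if T: "internal_set C T" and f: "f \<in> hom C Z T" for T f
  proof -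
    let ?t = "to_one C T"
    have TO: "T \<in> Obj C" using T unfolding internal_set_def by simp
    have t: "?t \<in> M" "?t \<in> hom C T (one C)"
      using sets[OF TO] T to_one_hom[OF TO] by auto
    have "orthogonal C e ?t" using fs e(1) t(1) unfolding factorization_system_def by blast
    moreover have "?t \<cdot> f = m \<cdot> e"
      using to_one_unique[OF Comp_hom[OF f t(2)]] to_one_unique[OF Comp_hom[OF e(2) m(2)]] by simp
    moreover have "Dom C e = Z" "Dom C ?t = T" "Cod C ?t = one C"
      using e t unfolding hom_def by auto
    ultimately have ex: "\<exists>!d. d \<in> hom C (Cod C e) T \<and> d \<cdot> e = f \<and> ?t \<cdot> d = m"
      using f m(2) unfolding orthogonal_def by auto
    moreover have "?t \<cdot> d = m" if "d \<in> hom C (Cod C e) T" for d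
      using to_one_unique[OF Comp_hom[OF that t(2)]] to_one_unique[OF m(2)] by simp
    ultimately show ?thesis by metis
  qed
  ultimately show ?thesis using e(2) unfolding reflection_map_def by blast
qed

lemma reflection_map_facE:
  assumes "Z \<in> Obj C"
  shows "reflection_map C Z (Cod C (facE C (to_one C Z))) (facE C (to_one C Z))"
proof (rule reflection_aux[OF fact_EM _ assms chosen_fac])
  show "internal_set C S \<longleftrightarrow> to_one C S \<in> clsM C" if "S \<in> Obj C" for S
    using that unfolding internal_set_def by simp
  show "to_one C Z \<in> Arr C" using to_one_hom[OF assms] unfolding hom_def by simp
qed

lemma reflection_map_facE':
  assumes "Z \<in> Obj C"
  shows "reflection_map C Z (Cod C (facE' C (to_one C Z))) (facE' C (to_one C Z))"
proof (rule reflection_aux[OF fact_EM' _ assms chosen_fac'])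
  show "internal_set C S \<longleftrightarrow> to_one C S \<in> clsM' C" if "S \<in> Obj C" for S
    using that same_over_one unfolding internal_set_def by simp
  show "to_one C Z \<in> Arr C" using to_one_hom[OF assms] unfolding hom_def by simp
qed

end

end

(* The pullback i of i_x along p is in E' and its domain S is an internal set, because p is a
   pullback of a map in M. So c i is in E', and in M' as a map between internal sets; hence it is
   an isomorphism. Exchanging the two factorization systems gives the claim on e. For the points of
   the fibre [alpha]: the induced point is the pullback of the section i_{x,y} of c along
   k : [alpha] -> X[x,y], and k is in M because alpha, a map of internal sets, is. *)
theory Submission
  imports Defs
begin

section \<open>Elimination rules for homs, pullback squares, lifts and factorization systems\<close>

lemma homI: "f \<in> Arr C \<Longrightarrow> f \<in> hom C (Dom C f) (Cod C f)"
  by (simp add: hom_def)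

lemma hom_Dom: "f \<in> hom C A B \<Longrightarrow> Dom C f = A"
  and hom_Cod: "f \<in> hom C A B \<Longrightarrow> Cod C f = B"
  and hom_Arr: "f \<in> hom C A B \<Longrightarrow> f \<in> Arr C"
  by (simp_all add: hom_def)

lemma is_pullback_hom:
  assumes "is_pullback C P p q f g"
  shows "f \<in> Arr C" "g \<in> Arr C" "Cod C f = Cod C g"
    "p \<in> hom C P (Dom C f)" "q \<in> hom C P (Dom C g)" "f \<cdot>\<^bsub>C\<^esub> p = g \<cdot>\<^bsub>C\<^esub> q"
  using assms by (simp_all add: is_pullback_def comm_square_def)

lemma is_pullback_ex1:
  assumes "is_pullback C P p q f g" "u \<in> hom C Q (Dom C f)" "v \<in> hom C Q (Dom C g)"
    "f \<cdot>\<^bsub>C\<^esub> u = g \<cdot>\<^bsub>C\<^esub> v"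
  shows "\<exists>!h. induced_by C P p q Q u v h"
  using assms by (simp add: is_pullback_def comm_square_def)

lemma is_pullback_sym:
  assumes "is_pullback C P p q f g"
  shows "is_pullback C P q p g f"
proof -
  have "comm_square C Q u v g f = comm_square C Q v u f g" for Q u v
    by (auto simp: comm_square_def)
  moreover have "induced_by C P q p Q u v h = induced_by C P p q Q v u h" for Q u v h
    by (auto simp: induced_by_def)
  ultimately show ?thesis using assms by (simp add: is_pullback_def)
qed

lemma orthogonal_ex1:
  assumes "orthogonal C e m" "e \<in> hom C A B" "m \<in> hom C K L"
    "u \<in> hom C A K" "v \<in> hom C B L" "m \<cdot>\<^bsub>C\<^esub> u = v \<cdot>\<^bsub>C\<^esub> e"
  shows "\<exists>!d. d \<in> hom C B K \<and> d \<cdot>\<^bsub>C\<^esub> e = u \<and> m \<cdot>\<^bsub>C\<^esub> d = v"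
  using assms by (auto simp: orthogonal_def hom_Dom hom_Cod)

lemma factorization_systemD:
  assumes "factorization_system C E M"
  shows "f \<in> E \<Longrightarrow> f \<in> Arr C" "f \<in> M \<Longrightarrow> f \<in> Arr C"
    "is_iso C f \<Longrightarrow> f \<in> E" "is_iso C f \<Longrightarrow> f \<in> M"
    "f \<in> E \<Longrightarrow> m \<in> M \<Longrightarrow> orthogonal C f m"
    "f \<in> Arr C \<Longrightarrow> \<exists>e m. factors_as C E M f e m"
  using assms by (auto simp: factorization_system_def)

lemma factorization_system_comp:
  assumes "factorization_system C E M" "f \<in> hom C A B" "g \<in> hom C B K"
  shows "f \<in> E \<Longrightarrow> g \<in> E \<Longrightarrow> g \<cdot>\<^bsub>C\<^esub> f \<in> E" "f \<in> M \<Longrightarrow> g \<in> M \<Longrightarrow> g \<cdot>\<^bsub>C\<^esub> f \<in> M"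
  using assms by (auto simp: factorization_system_def closed_under_comp_def hom_Dom hom_Cod)

section \<open>Isomorphisms and the closure properties of a single factorization system\<close>

context category
begin

lemma is_isoI:
  assumes "f \<in> hom C A B" "g \<in> hom C B A" "g \<cdot> f = Ide C A" "f \<cdot> g = Ide C B"
  shows "is_iso C f"
  using assms by (auto simp: is_iso_def inverse_arrows_def hom_def)

text \<open>This makes the definite description in \<open>inv_arr\<close> denote the
  inverse.\<close>

lemma inverse_arrows_unique:
  assumes "inverse_arrows C f g" "inverse_arrows C f h"
  shows "g = h"
proof -
  let ?A = "Dom C f" and ?B = "Cod C f"
  have f: "f \<in> hom C ?A ?B" and g: "g \<in> hom C ?B ?A" and h: "h \<in> hom C ?B ?A"
    using assms by (auto simp: inverse_arrows_def hom_def)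
  have "(g \<cdot> f) \<cdot> h = g \<cdot> (f \<cdot> h)" by (rule Comp_assoc[OF h f g])
  then show ?thesis
    using assms Comp_Ide_left[OF h] Comp_Ide_right[OF g] by (simp add: inverse_arrows_def)
qed

lemma inv_arr:
  assumes f: "f \<in> hom C A B" and "is_iso C f"
  shows "inv_arr C f \<in> hom C B A" "inv_arr C f \<cdot> f = Ide C A" "f \<cdot> inv_arr C f = Ide C B"
    "is_iso C (inv_arr C f)"
proof -
  obtain g where "inverse_arrows C f g" using assms by (auto simp: is_iso_def)
  then have "inverse_arrows C f (inv_arr C f)"
    unfolding inv_arr_def using inverse_arrows_unique by (blast intro: theI)
  then show *: "inv_arr C f \<in> hom C B A" "inv_arr C f \<cdot> f = Ide C A" "f \<cdot> inv_arr C f = Ide C B"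
    using f by (simp_all add: inverse_arrows_def hom_Dom hom_Cod)
  show "is_iso C (inv_arr C f)" by (rule is_isoI[OF *(1) f *(3,2)])
qed

lemma Ide_is_iso: "A \<in> Obj C \<Longrightarrow> is_iso C (Ide C A)"
  by (rule is_isoI) (auto intro: Ide_hom Comp_Ide_left[OF Ide_hom])

text \<open>The square from \<open>f\<close> to itself with identities as the other two sides has a
  lift, and that lift is a two-sided inverse.\<close>

lemma orthogonal_self_imp_iso:
  assumes f: "f \<in> hom C A B" and "orthogonal C f f"
  shows "is_iso C f"
proof -
  have "A \<in> Obj C" "B \<in> Obj C" using f Dom_Obj[of f] Cod_Obj[of f] by (auto simp: hom_def)
  then have I: "Ide C A \<in> hom C A A" "Ide C B \<in> hom C B B" by (simp_all add: Ide_hom)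
  have "f \<cdot> Ide C A = Ide C B \<cdot> f" using f by (simp add: Comp_Ide_right Comp_Ide_left)
  from orthogonal_ex1[OF assms(2) f f I this] show ?thesis using f by (blast intro: is_isoI)
qed

lemma E_M_imp_iso:
  assumes fs: "factorization_system C E M" and "f \<in> E" "f \<in> M"
  shows "is_iso C f"
  using assms factorization_systemD[OF fs] by (blast intro: orthogonal_self_imp_iso homI)

text \<open>Retract argument: in a factorization \<open>f = m e\<close>, a lift of \<open>e\<close>
  against \<open>f\<close> splits \<open>e\<close>, and uniqueness of lifts of \<open>e\<close>
  against \<open>m\<close> turns the splitting into an inverse. So \<open>M\<close> is the whole
  right orthogonal class of \<open>E\<close>, and closure properties of \<open>M\<close> can be
  checked by lifting.\<close>

lemma right_orthogonal_in_M:
  assumes fs: "factorization_system C E M" and f: "f \<in> Arr C"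
    and orth: "\<And>e. e \<in> E \<Longrightarrow> orthogonal C e f"
  shows "f \<in> M"
proof -
  obtain e m where "factors_as C E M f e m" using factorization_systemD(6)[OF fs f] by blast
  then have eE: "e \<in> E" and mM: "m \<in> M" and me: "m \<cdot> e = f"
    and doms: "Dom C e = Dom C f" "Cod C e = Dom C m" "Cod C m = Cod C f"
    by (auto simp: factors_as_def)
  let ?A = "Dom C f" and ?B = "Cod C f" and ?K = "Cod C e"
  have e: "e \<in> hom C ?A ?K" and m: "m \<in> hom C ?K ?B"
    using eE mM doms factorization_systemD(1,2)[OF fs] by (auto simp: hom_def)
  have f': "f \<in> hom C ?A ?B" using f by (rule homI)
  have IA: "Ide C ?A \<in> hom C ?A ?A" and IK: "Ide C ?K \<in> hom C ?K ?K"
    using Ide_hom Dom_Obj[OF f] Cod_Obj[OF hom_Arr[OF e]] by auto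
  \<comment> \<open>Read as a square from \<open>e\<close> to \<open>f\<close> with the identity
    opposite to \<open>m\<close>; its lift \<open>d\<close> is the splitting.\<close>
  have "f \<cdot> Ide C ?A = m \<cdot> e" using me f' by (simp add: Comp_Ide_right)
  from orthogonal_ex1[OF orth[OF eE] e f' IA m this]
  obtain d where d: "d \<in> hom C ?K ?A" "d \<cdot> e = Ide C ?A" "f \<cdot> d = m" by blast
  \<comment> \<open>Both \<open>e d\<close> and the identity fill this square from \<open>e\<close>
    to \<open>m\<close>, hence they agree.\<close>
  have "\<exists>!l. l \<in> hom C ?K ?K \<and> l \<cdot> e = e \<and> m \<cdot> l = m"
    by (rule orthogonal_ex1[OF factorization_systemD(5)[OF fs eE mM] e m e m refl])
  moreover have "(e \<cdot> d) \<cdot> e = e"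
    using Comp_assoc[OF e d(1) e] d(2) Comp_Ide_right[OF e] by simp
  moreover have "m \<cdot> (e \<cdot> d) = m" using Comp_assoc[OF d(1) e m] me d(3) by simp
  moreover have "e \<cdot> d \<in> hom C ?K ?K" using d(1) e by (rule Comp_hom)
  ultimately have "e \<cdot> d = Ide C ?K"
    using IK Comp_Ide_left[OF e] Comp_Ide_right[OF m] by blast
  then have "is_iso C e" using is_isoI[OF e d(1,2)] by simp
  then have "e \<in> M" by (rule factorization_systemD(4)[OF fs])
  then show ?thesis using factorization_system_comp(2)[OF fs e m] mM me by simp
qed

text \<open>A lift against \<open>g f\<close> solves the problem for \<open>f\<close> after
  \<open>g\<close>; uniqueness of lifts against \<open>g\<close> removes the \<open>g\<close>.
  Conversely every lift against \<open>f\<close> is one against \<open>g f\<close>, which gives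
  uniqueness.\<close>

lemma M_cancel:
  assumes fs: "factorization_system C E M" and f: "f \<in> hom C A B" and g: "g \<in> hom C B K"
    and gM: "g \<in> M" and gfM: "g \<cdot> f \<in> M"
  shows "f \<in> M"
proof (rule right_orthogonal_in_M[OF fs hom_Arr[OF f]])
  fix e assume eE: "e \<in> E"
  then have e: "e \<in> hom C (Dom C e) (Cod C e)" by (rule homI[OF factorization_systemD(1)[OF fs]])
  have gf: "g \<cdot> f \<in> hom C A K" using f g by (rule Comp_hom)
  show "orthogonal C e f"
    unfolding orthogonal_def hom_Dom[OF f] hom_Cod[OF f]
  proof (intro ballI impI)
    fix u v assume u: "u \<in> hom C (Dom C e) A" and v: "v \<in> hom C (Cod C e) B"
      and eq: "f \<cdot> u = v \<cdot> e"
    have gv: "g \<cdot> v \<in> hom C (Cod C e) K" using v g by (rule Comp_hom)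
    have sq: "(g \<cdot> f) \<cdot> u = (g \<cdot> v) \<cdot> e"
      using eq Comp_assoc[OF u f g] Comp_assoc[OF e v g] by simp
    have ex1: "\<exists>!d. d \<in> hom C (Cod C e) A \<and> d \<cdot> e = u \<and> (g \<cdot> f) \<cdot> d = g \<cdot> v"
      by (rule orthogonal_ex1[OF factorization_systemD(5)[OF fs eE gfM] e gf u gv sq])
    moreover have "f \<cdot> d = v"
      if d: "d \<in> hom C (Cod C e) A" "d \<cdot> e = u" "(g \<cdot> f) \<cdot> d = g \<cdot> v" for d
    proof -
      have fd: "f \<cdot> d \<in> hom C (Cod C e) B" using d(1) f by (rule Comp_hom)
      have "(f \<cdot> d) \<cdot> e = v \<cdot> e" using Comp_assoc[OF e d(1) f] d(2) eq by simp
      moreover have "g \<cdot> (f \<cdot> d) = g \<cdot> v" using Comp_assoc[OF d(1) f g] d(3) by simp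
      \<comment> \<open>Both \<open>f d\<close> and \<open>v\<close> lift this square against
        \<open>g\<close>.\<close>
      moreover have "\<exists>!l. l \<in> hom C (Cod C e) B \<and> l \<cdot> e = v \<cdot> e \<and> g \<cdot> l = g \<cdot> v"
        by (rule orthogonal_ex1[OF factorization_systemD(5)[OF fs eE gM] e g
              Comp_hom[OF e v] gv Comp_assoc[OF e v g, symmetric]])
      ultimately show ?thesis using fd v by blast
    qed
    moreover have "(g \<cdot> f) \<cdot> d = g \<cdot> v" if "d \<in> hom C (Cod C e) A" "f \<cdot> d = v" for d
      using Comp_assoc[OF that(1) f g] that(2) by simp
    ultimately show "\<exists>!d. d \<in> hom C (Cod C e) A \<and> d \<cdot> e = u \<and> f \<cdot> d = v"
      by metis
  qed
qed

text \<open>Lifts against \<open>q\<close> correspond to lifts against \<open>f\<close>: compose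
  with \<open>p\<close> in one direction, use the universal property of \<open>P\<close> in the
  other.\<close>

lemma pullback_in_M:
  assumes fs: "factorization_system C E M" and pb: "is_pullback C P p q f g" and fM: "f \<in> M"
  shows "q \<in> M"
proof (rule right_orthogonal_in_M[OF fs])
  note pbh = is_pullback_hom[OF pb]
  have f: "f \<in> hom C (Dom C f) (Cod C f)" and g: "g \<in> hom C (Dom C g) (Cod C f)"
    using pbh by (auto simp: hom_def)
  note p = pbh(4) and q = pbh(5)
  show "q \<in> Arr C" using q by (rule hom_Arr)
  fix e assume eE: "e \<in> E"
  then have e: "e \<in> hom C (Dom C e) (Cod C e)" by (rule homI[OF factorization_systemD(1)[OF fs]])
  show "orthogonal C e q"
    unfolding orthogonal_def hom_Dom[OF q] hom_Cod[OF q]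
  proof (intro ballI impI)
    fix u v assume u: "u \<in> hom C (Dom C e) P" and v: "v \<in> hom C (Cod C e) (Dom C g)"
      and eq: "q \<cdot> u = v \<cdot> e"
    have pu: "p \<cdot> u \<in> hom C (Dom C e) (Dom C f)" using u p by (rule Comp_hom)
    have gv: "g \<cdot> v \<in> hom C (Cod C e) (Cod C f)" using v g by (rule Comp_hom)
    have sq: "f \<cdot> (p \<cdot> u) = (g \<cdot> v) \<cdot> e"
      using Comp_assoc[OF u p f] Comp_assoc[OF u q g] Comp_assoc[OF e v g] pbh(6) eq by simp
    have lift: "\<exists>!d. d \<in> hom C (Cod C e) (Dom C f) \<and> d \<cdot> e = p \<cdot> u \<and> f \<cdot> d = g \<cdot> v"
      by (rule orthogonal_ex1[OF factorization_systemD(5)[OF fs eE fM] e f pu gv sq])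
    then obtain d where d: "d \<in> hom C (Cod C e) (Dom C f)" "d \<cdot> e = p \<cdot> u" "f \<cdot> d = g \<cdot> v"
      by blast
    have ind: "\<exists>!h. induced_by C P p q (Cod C e) d v h" by (rule is_pullback_ex1[OF pb d(1) v d(3)])
    then obtain h where h: "h \<in> hom C (Cod C e) P" "p \<cdot> h = d" "q \<cdot> h = v"
      by (auto simp: induced_by_def)
    have he: "h \<cdot> e \<in> hom C (Dom C e) P" using e h(1) by (rule Comp_hom)
    have qu: "q \<cdot> u \<in> hom C (Dom C e) (Dom C g)" using u q by (rule Comp_hom)
    have "f \<cdot> (p \<cdot> u) = g \<cdot> (q \<cdot> u)"
      using Comp_assoc[OF u p f] Comp_assoc[OF u q g] pbh(6) by simp
    then have "\<exists>!l. induced_by C P p q (Dom C e) (p \<cdot> u) (q \<cdot> u) l"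
      by (rule is_pullback_ex1[OF pb pu qu])
    moreover have "induced_by C P p q (Dom C e) (p \<cdot> u) (q \<cdot> u) u"
      using u by (simp add: induced_by_def)
    moreover have "induced_by C P p q (Dom C e) (p \<cdot> u) (q \<cdot> u) (h \<cdot> e)"
      using he Comp_assoc[OF e h(1) p] Comp_assoc[OF e h(1) q] h d eq by (simp add: induced_by_def)
    \<comment> \<open>Maps into \<open>P\<close> are determined by their composites with
      \<open>p\<close> and \<open>q\<close>.\<close>
    ultimately have heu: "h \<cdot> e = u" by blast
    moreover have "l = h" if l: "l \<in> hom C (Cod C e) P" "l \<cdot> e = u" "q \<cdot> l = v" for l
    \<comment> \<open>Composing a competitor \<open>l\<close> with \<open>p\<close> gives a second
      lift against \<open>f\<close>, so \<open>p l = d\<close>; then \<open>l\<close> and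
      \<open>h\<close> have the same two components.\<close>
    proof -
      have "p \<cdot> l \<in> hom C (Cod C e) (Dom C f)" using l(1) p by (rule Comp_hom)
      moreover have "(p \<cdot> l) \<cdot> e = p \<cdot> u" using Comp_assoc[OF e l(1) p] l(2) by simp
      moreover have "f \<cdot> (p \<cdot> l) = g \<cdot> v"
        using Comp_assoc[OF l(1) p f] Comp_assoc[OF l(1) q g] pbh(6) l(3) by simp
      ultimately have "p \<cdot> l = d" using lift d by blast
      then show ?thesis using ind l h by (auto simp: induced_by_def)
    qed
    ultimately show "\<exists>!d. d \<in> hom C (Cod C e) P \<and> d \<cdot> e = u \<and> q \<cdot> d = v"
      using h by blast
  qed
qed

text \<open>An instance of the pasting law: the square of \<open>h\<close> over \<open>j\<close>
  followed by the fibre square of \<open>r\<close> over \<open>c\<close> has identities as its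
  horizontal composites and is thus a pullback, so the first square is one too. Hence
  \<open>h\<close> is the pullback of the section \<open>j\<close> along \<open>k\<close>, which is
  the form that the stability axioms require.\<close>

lemma section_fibre_point:
  assumes pb: "is_pullback C F r k \<alpha> c" and \<alpha>: "\<alpha> \<in> hom C A B" and c: "c \<in> hom C Z B"
    and j: "j \<in> hom C B Z" and cj: "c \<cdot> j = Ide C B"
  shows "\<exists>!h. induced_by C F r k A (Ide C A) (j \<cdot> \<alpha>) h"
    and "induced_by C F r k A (Ide C A) (j \<cdot> \<alpha>) h \<Longrightarrow> is_pullback C A \<alpha> h j k"
proof -
  note D = hom_Dom[OF \<alpha>] hom_Dom[OF c] hom_Dom[OF j] hom_Cod[OF \<alpha>] hom_Cod[OF c] hom_Cod[OF j]
  have r: "r \<in> hom C F A" and k: "k \<in> hom C F Z" and sq: "\<alpha> \<cdot> r = c \<cdot> k"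
    using is_pullback_hom[OF pb] D by auto
  have IA: "Ide C A \<in> hom C A A" using Ide_hom Dom_Obj[OF hom_Arr[OF \<alpha>]] D by simp
  have j\<alpha>: "j \<cdot> \<alpha> \<in> hom C A Z" using \<alpha> j by (rule Comp_hom)
  have "\<alpha> \<cdot> Ide C A = c \<cdot> (j \<cdot> \<alpha>)"
    using Comp_assoc[OF \<alpha> j c] cj Comp_Ide_left[OF \<alpha>] Comp_Ide_right[OF \<alpha>] by simp
  then show "\<exists>!h. induced_by C F r k A (Ide C A) (j \<cdot> \<alpha>) h"
    using is_pullback_ex1[OF pb] IA j\<alpha> D by simp
  assume "induced_by C F r k A (Ide C A) (j \<cdot> \<alpha>) h"
  then have h: "h \<in> hom C A F" "r \<cdot> h = Ide C A" "k \<cdot> h = j \<cdot> \<alpha>"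
    by (auto simp: induced_by_def)
  have "\<exists>!w. induced_by C A \<alpha> h Q u v w" if uv: "comm_square C Q u v j k" for Q u v
  proof -
    have u: "u \<in> hom C Q B" and v: "v \<in> hom C Q F" and eq: "j \<cdot> u = k \<cdot> v"
      using uv D hom_Dom[OF k] by (auto simp: comm_square_def)
    have rv: "r \<cdot> v \<in> hom C Q A" using v r by (rule Comp_hom)
    have hrv: "h \<cdot> (r \<cdot> v) \<in> hom C Q F" using rv h(1) by (rule Comp_hom)
    \<comment> \<open>Applying \<open>c\<close> to \<open>j u = k v\<close> recovers
      \<open>u\<close> from \<open>r v\<close>, so \<open>r v\<close> is the candidate for the
      mediating map.\<close>
    have "u = (c \<cdot> j) \<cdot> u" using cj Comp_Ide_left[OF u] by simp
    also have "\<dots> = c \<cdot> (k \<cdot> v)" using Comp_assoc[OF u j c] eq by simp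
    also have "\<dots> = \<alpha> \<cdot> (r \<cdot> v)" using Comp_assoc[OF v k c] Comp_assoc[OF v r \<alpha>] sq by simp
    finally have ueq: "\<alpha> \<cdot> (r \<cdot> v) = u" by simp
    have "r \<cdot> (h \<cdot> (r \<cdot> v)) = r \<cdot> v"
      using Comp_assoc[OF rv h(1) r] h(2) Comp_Ide_left[OF rv] by simp
    moreover have "k \<cdot> (h \<cdot> (r \<cdot> v)) = k \<cdot> v"
      using Comp_assoc[OF rv h(1) k] h(3) Comp_assoc[OF rv \<alpha> j] ueq eq by simp
    \<comment> \<open>\<open>h (r v)\<close> and \<open>v\<close> have equal composites with
      \<open>r\<close> and \<open>k\<close>, so they coincide as maps into the fibre.\<close>
    moreover have "\<exists>!l. induced_by C F r k Q (r \<cdot> v) (k \<cdot> v) l"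
    proof (rule is_pullback_ex1[OF pb])
      show "\<alpha> \<cdot> (r \<cdot> v) = c \<cdot> (k \<cdot> v)"
        using Comp_assoc[OF v k c] Comp_assoc[OF v r \<alpha>] sq by simp
    qed (use rv Comp_hom[OF v k] D in simp_all)
    ultimately have "h \<cdot> (r \<cdot> v) = v"
      using v hrv unfolding induced_by_def by blast
    moreover have "w = r \<cdot> v" if w: "w \<in> hom C Q A" "h \<cdot> w = v" for w
      using Comp_assoc[OF w(1) h(1) r] h(2) Comp_Ide_left[OF w(1)] w(2) by simp
    ultimately show ?thesis using rv ueq unfolding induced_by_def by metis
  qed
  then show "is_pullback C A \<alpha> h j k"
    using \<alpha> j k h hom_Dom[OF k] hom_Cod[OF k] D
    by (auto simp: is_pullback_def comm_square_def hom_Arr)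
qed

end

section \<open>Internal sets and their reflection maps\<close>

context balanced_factorization_category
begin

text \<open>Identities are in \<open>M\<close>. This lets an element \<alpha> of an internal set
  count as a map between internal sets.\<close>

lemma one_internal_set: "internal_set C (one C)"
proof -
  have one: "one C \<in> Obj C" using terminal_one by (simp add: is_terminal_def)
  then have "Ide C (one C) \<in> clsM C"
    by (intro factorization_systemD(4)[OF fact_EM] Ide_is_iso)
  then show ?thesis
    using one to_one_unique[OF Ide_hom[OF one]] by (simp add: internal_set_def)
qed

lemma internal_setD:
  assumes "internal_set C S"
  shows "S \<in> Obj C" "to_one C S \<in> hom C S (one C)" "to_one C S \<in> clsM C" "to_one C S \<in> clsM' C"
  using assms same_over_one by (auto simp: internal_set_def to_one_hom)

text \<open>Either class suffices because the two classes agree over the terminal object; this is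
  what allows the two systems to be exchanged.\<close>

lemma internal_setI:
  assumes "s \<in> hom C S (one C)" "s \<in> clsM C \<or> s \<in> clsM' C"
  shows "internal_set C S"
  using assms to_one_unique[OF assms(1)] same_over_one Dom_Obj[of s]
  by (auto simp: internal_set_def hom_def)

text \<open>Cancel the map from \<open>T\<close> to the terminal object, in each of the two
  systems.\<close>

lemma internal_set_map_in_M:
  assumes S: "internal_set C S" and T: "internal_set C T" and f: "f \<in> hom C S T"
  shows "f \<in> clsM C" "f \<in> clsM' C"
proof -
  note T' = internal_setD[OF T] and S' = internal_setD[OF S]
  have "to_one C T \<cdot> f = to_one C S" using Comp_hom[OF f T'(2)] by (rule to_one_unique)
  then show "f \<in> clsM C" "f \<in> clsM' C"
    using M_cancel[OF fact_EM f T'(2)] M_cancel[OF fact_EM' f T'(2)] T' S' by simp_all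
qed

text \<open>The usual comparison of universal arrows; it transfers facts about the chosen
  factorizations to an arbitrary reflection map.\<close>

lemma reflection_map_unique:
  assumes c: "reflection_map C Z H c" and c': "reflection_map C Z K c'"
  shows "\<exists>j. j \<in> hom C K H \<and> is_iso C j \<and> j \<cdot> c' = c"
proof -
  have ch: "c \<in> hom C Z H" and c'h: "c' \<in> hom C Z K"
    and H: "internal_set C H" and K: "internal_set C K"
    using c c' by (auto simp: reflection_map_def)
  have univ: "\<And>T f. internal_set C T \<Longrightarrow> f \<in> hom C Z T \<Longrightarrow> \<exists>!g. g \<in> hom C H T \<and> g \<cdot> c = f"
    and univ': "\<And>T f. internal_set C T \<Longrightarrow> f \<in> hom C Z T \<Longrightarrow> \<exists>!g. g \<in> hom C K T \<and> g \<cdot> c' = f"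
    using c c' by (simp_all add: reflection_map_def)
  obtain g where g: "g \<in> hom C H K" "g \<cdot> c = c'" using univ[OF K c'h] by blast
  obtain j where j: "j \<in> hom C K H" "j \<cdot> c' = c" using univ'[OF H ch] by blast
  have "(j \<cdot> g) \<cdot> c = c" using Comp_assoc[OF ch g(1) j(1)] g j by simp
  then have "j \<cdot> g = Ide C H"
    using univ[OF H ch] Comp_hom[OF g(1) j(1)] Ide_hom[OF internal_setD(1)[OF H]]
      Comp_Ide_left[OF ch] by blast
  moreover have "(g \<cdot> j) \<cdot> c' = c'" using Comp_assoc[OF c'h j(1) g(1)] g j by simp
  then have "g \<cdot> j = Ide C K"
    using univ'[OF K c'h] Comp_hom[OF j(1) g(1)] Ide_hom[OF internal_setD(1)[OF K]]
      Comp_Ide_left[OF c'h] by blast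
  ultimately show ?thesis using is_isoI[OF j(1) g(1)] j by blast
qed

text \<open>Factorizing the map from \<open>Z\<close> to the terminal object in either system yields
  a reflection into the same internal sets. So \<open>c\<close> differs by an isomorphism both from
  a map in \<open>E\<close> and from a map in \<open>E'\<close>.\<close>

lemma reflection_map_in_E:
  assumes c: "reflection_map C Z H c"
  shows "c \<in> clsE C" "c \<in> clsE' C"
proof -
  have Z: "Z \<in> Obj C"
    using c Dom_Obj[of c] by (auto simp: reflection_map_def hom_def)
  have a: "to_one C Z \<in> Arr C" by (rule hom_Arr[OF to_one_hom[OF Z]])
  let ?e = "facE C (to_one C Z)" and ?e' = "facE' C (to_one C Z)"
  have r: "reflection_map C Z (Cod C ?e) ?e" by (rule reflection_map_facE[OF Z])
  have r': "reflection_map C Z (Cod C ?e') ?e'" by (rule reflection_map_facE'[OF Z])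
  have e: "?e \<in> hom C Z (Cod C ?e)" "?e \<in> clsE C"
    using r chosen_fac[OF a] by (auto simp: reflection_map_def factors_as_def)
  have e': "?e' \<in> hom C Z (Cod C ?e')" "?e' \<in> clsE' C"
    using r' chosen_fac'[OF a] by (auto simp: reflection_map_def factors_as_def)
  obtain j where j: "j \<in> hom C (Cod C ?e) H" "is_iso C j" "j \<cdot> ?e = c"
    using reflection_map_unique[OF c r] by blast
  obtain j' where j': "j' \<in> hom C (Cod C ?e') H" "is_iso C j'" "j' \<cdot> ?e' = c"
    using reflection_map_unique[OF c r'] by blast
  show "c \<in> clsE C"
    using factorization_system_comp(1)[OF fact_EM e(1) j(1) e(2)]
      factorization_systemD(3)[OF fact_EM j(2)] j(3) by simp
  show "c \<in> clsE' C"
    using factorization_system_comp(1)[OF fact_EM' e'(1) j'(1) e'(2)]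
      factorization_systemD(3)[OF fact_EM' j'(2)] j'(3) by simp
qed

text \<open>Stated for an arbitrary system so as to serve \<open>i\<close> with the primed classes
  and \<open>e\<close> with the unprimed ones. The composite \<open>c j\<close> is in both
  \<open>E\<close> and \<open>M\<close>, hence invertible, and \<sigma> stays in \<open>E\<close> as
  an isomorphism followed by \<open>j\<close>.\<close>

lemma internal_set_section:
  assumes fs: "factorization_system C E M" and c: "reflection_map C Z H c" and cE: "c \<in> E"
    and j: "j \<in> hom C S Z" and jE: "j \<in> E" and cjM: "c \<cdot> j \<in> M"
  defines "\<sigma> \<equiv> j \<cdot> inv_arr C (c \<cdot> j)"
  shows "is_iso C (c \<cdot> j)" "\<sigma> \<in> hom C H Z" "\<sigma> \<in> E" "c \<cdot> \<sigma> = Ide C H"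
proof -
  have ch: "c \<in> hom C Z H" using c by (simp add: reflection_map_def)
  have cj: "c \<cdot> j \<in> hom C S H" using j ch by (rule Comp_hom)
  have "c \<cdot> j \<in> E" by (rule factorization_system_comp(1)[OF fs j ch jE cE])
  then show iso: "is_iso C (c \<cdot> j)" using cjM by (rule E_M_imp_iso[OF fs])
  note inv = inv_arr[OF cj iso]
  show "\<sigma> \<in> hom C H Z" unfolding \<sigma>_def using inv(1) j by (rule Comp_hom)
  show "\<sigma> \<in> E" unfolding \<sigma>_def
    by (rule factorization_system_comp(1)[OF fs inv(1) j factorization_systemD(3)[OF fs inv(4)] jE])
  show "c \<cdot> \<sigma> = Ide C H"
    unfolding \<sigma>_def using Comp_assoc[OF inv(1) j ch] inv(3) by simp
qed

end

theorem mainTheorem11: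
  fixes C :: "('o, 'a, 'z) bfc_scheme" (structure)
    and X P H S S' :: 'o
    and x y p q c i s e t :: 'a
  assumes bfc: "balanced_factorization_category C"
    and X: "X \<in> Obj C"
    and x: "x \<in> hom C (one C) X"
    and y: "y \<in> hom C (one C) X"
    and P: "is_pullback C P p q (coslice_map C x) (slice_map C y)"
    and c: "reflection_map C P H c"
    and i: "is_pullback C S s i (coslice_pt C x) p"
    and e: "is_pullback C S' t e (slice_pt C y) q"
  shows "is_iso C (c \<cdot> i) \<and> is_iso C (c \<cdot> e) \<and>
    (let ixy = i \<cdot> inv_arr C (c \<cdot> i);
         exy = e \<cdot> inv_arr C (c \<cdot> e)
     in balanced_cylinder C H P ixy exy c \<and>
        (\<forall>\<alpha> \<in> hom C (one C) H. \<forall>F k r. is_pullback C F r k \<alpha> c \<longrightarrow>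
           (\<exists>!h. induced_by C F r k (one C) (Ide C (one C)) (ixy \<cdot> \<alpha>) h) \<and>
           (\<forall>h. induced_by C F r k (one C) (Ide C (one C)) (ixy \<cdot> \<alpha>) h \<longrightarrow> h \<in> clsE' C) \<and>
           (\<exists>!h. induced_by C F r k (one C) (Ide C (one C)) (exy \<cdot> \<alpha>) h) \<and>
           (\<forall>h. induced_by C F r k (one C) (Ide C (one C)) (exy \<cdot> \<alpha>) h \<longrightarrow> h \<in> clsE C)))"
proof -
  interpret balanced_factorization_category C by (rule bfc)
  note Pq = is_pullback_hom[OF P] and iq = is_pullback_hom[OF i] and eq = is_pullback_hom[OF e]
  have fy: "factors_as C (clsE C) (clsM C) y (slice_pt C y) (slice_map C y)"
    unfolding slice_pt_def slice_map_def by (rule chosen_fac[OF hom_Arr[OF y]])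
  have fx: "factors_as C (clsE' C) (clsM' C) x (coslice_pt C x) (coslice_map C x)"
    unfolding coslice_pt_def coslice_map_def by (rule chosen_fac'[OF hom_Arr[OF x]])
  \<comment> \<open>The classes cross over: \<open>p\<close> is the pullback of the slice map, so
    the square has to be flipped, while \<open>q\<close> is the pullback of the coslice map.\<close>
  have pM: "p \<in> clsM C"
    using pullback_in_M[OF fact_EM is_pullback_sym[OF P]] fy by (simp add: factors_as_def)
  have qM: "q \<in> clsM' C"
    using pullback_in_M[OF fact_EM' P] fx by (simp add: factors_as_def)
  \<comment> \<open>The mixed stability axioms apply exactly because of this crossing:
    \<open>E'\<close> is stable along \<open>M\<close>, and \<open>E\<close> along
    \<open>M'\<close>.\<close>
  have iE: "i \<in> clsE' C" using E'_stable[OF i _ pM] fx by (simp add: factors_as_def)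
  have eE: "e \<in> clsE C" using E_stable[OF e _ qM] fy by (simp add: factors_as_def)
  have ih: "i \<in> hom C S P" and eh: "e \<in> hom C S' P"
    using iq(5) eq(5) Pq(4,5) by (simp_all add: hom_Dom)
  \<comment> \<open>\<open>s\<close> and \<open>t\<close> are the pullbacks of \<open>p\<close> and
    \<open>q\<close> along maps out of the terminal object, so they are the terminal maps of
    \<open>S\<close> and \<open>S'\<close>, and they lie in \<open>M\<close> and \<open>M'\<close>
    respectively.\<close>
  have "s \<in> hom C S (one C)" "t \<in> hom C S' (one C)"
    using iq(4) eq(4) fx fy x y by (simp_all add: factors_as_def hom_Dom)
  then have S: "internal_set C S" and S': "internal_set C S'"
    using pullback_in_M[OF fact_EM is_pullback_sym[OF i] pM]
      pullback_in_M[OF fact_EM' is_pullback_sym[OF e] qM] by (auto intro: internal_setI)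
  have ch: "c \<in> hom C P H" and H: "internal_set C H" using c by (simp_all add: reflection_map_def)
  note cE = reflection_map_in_E[OF c]
  define ixy where "ixy = i \<cdot> inv_arr C (c \<cdot> i)"
  define exy where "exy = e \<cdot> inv_arr C (c \<cdot> e)"
  note isec = internal_set_section[OF fact_EM' c cE(2) ih iE
      internal_set_map_in_M(2)[OF S H Comp_hom[OF ih ch]], folded ixy_def]
  note esec = internal_set_section[OF fact_EM c cE(1) eh eE
      internal_set_map_in_M(1)[OF S' H Comp_hom[OF eh ch]], folded exy_def]
  have "balanced_cylinder C H P ixy exy c"
    using isec esec ch cE by (simp add: balanced_cylinder_def)
  moreover have "(\<exists>!h. induced_by C F r k (one C) (Ide C (one C)) (ixy \<cdot> \<alpha>) h) \<and>
      (\<forall>h. induced_by C F r k (one C) (Ide C (one C)) (ixy \<cdot> \<alpha>) h \<longrightarrow> h \<in> clsE' C) \<and>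
      (\<exists>!h. induced_by C F r k (one C) (Ide C (one C)) (exy \<cdot> \<alpha>) h) \<and>
      (\<forall>h. induced_by C F r k (one C) (Ide C (one C)) (exy \<cdot> \<alpha>) h \<longrightarrow> h \<in> clsE C)"
    if \<alpha>: "\<alpha> \<in> hom C (one C) H" and F: "is_pullback C F r k \<alpha> c" for \<alpha> F k r
  proof -
    \<comment> \<open>\<open>k\<close> is the pullback of \<alpha>, a map between internal sets and
      therefore in both right classes.\<close>
    have k: "k \<in> clsM C" "k \<in> clsM' C"
      using pullback_in_M[OF fact_EM F] pullback_in_M[OF fact_EM' F]
        internal_set_map_in_M[OF one_internal_set H \<alpha>] by simp_all
    note ipt = section_fibre_point[OF F \<alpha> ch isec(2,4)]
    note ept = section_fibre_point[OF F \<alpha> ch esec(2,4)]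
    show ?thesis
      \<comment> \<open>Any induced point is a pullback of \<open>ixy\<close> or \<open>exy\<close>
        along \<open>k\<close>, so stability passes \<open>E'\<close> or \<open>E\<close> on to
        it.\<close>
      using ipt(1) ept(1) E'_stable[OF ipt(2) isec(3) k(1)] E_stable[OF ept(2) esec(3) k(2)]
      by blast
  qed
  ultimately show ?thesis
    using isec(1) esec(1) unfolding Let_def ixy_def exy_def by blast
qed

end
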